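(* Let $\chi\subset\mathbb{C}^n$ be closed and convex, let $A:=M(\chi)$ and $B:=\{y\in\mathbb{C}^N : |y|^2=r\}$, let $\hat y\in A\cap B$, and let $T_{\mathtt{DRAP}}$ be the DRAP operator with parameter $\lambda\in[0,1]$ associated with $A$ and $B$. Suppose that the set-valued mapping $\Psi:=T_{\mathtt{DRAP}}-\mathrm{Id}$ is metrically subregular at $\hat y$ for $0$. Then every sequence generated by $T_{\mathtt{DRAP}}$ (i.e. $y^{(k+1)}\in T_{\mathtt{DRAP}}(y^{(k)})$ for all $k\ge 0$) converges linearly to a fixed point of $T_{\mathtt{DRAP}}$, provided that the initial point $y^{(0)}$ is sufficiently close to $\hat y$.
   Context: $m\ge 2$ and $n$ are positive integers, $N=mn$. The propagation matrix is $$M=\frac{1}{\sqrt m}\begin{pmatrix}FD_1\\ FD_2\\ \vdots\\ FD_m\end{pmatrix}\in\mathbb{C}^{N\times n},$$ where $F\in\mathbb{C}^{n\times n}$ is the unitary matrix representing the discrete Fourier transform and $D_1,\dots,D_m\in\mathbb{C}^{n\times n}$ are unitary matrices (representing the addition of phase diversities); thus $M^*M=I_n$. $r\in\mathbb{R}_+^N$ is the data vector; $|\cdot|^2$ of a vector is entrywise. $\mathbb{C}^N$ is regarded as a finite dimensional Hilbert space with the Euclidean norm. For a set $\Omega$, $\operatorname{dist}(x,\Omega)=\inf_{w\in\Omega}\|x-w\|$ and $P_\Omega(x)=\{w\in\Omega : \|x-w\|=\operatorname{dist}(x,\Omega)\}$ (set-valued projector). The DRAP operator with relaxation parameter $\lambda\in[0,1]$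 is $T_{\mathtt{DRAP}}=P_A\left((1+\lambda)P_B-\lambda\,\mathrm{Id}\right)-\lambda(P_B-\mathrm{Id})$, i.e. $T_{\mathtt{DRAP}}(y)=\{p-\lambda(b-y) : b\in P_B(y),\ p\in P_A((1+\lambda)b-\lambda y)\}$ (the same selection $b$ is used in both places). A fixed point of $T$ is a point $y$ with $y\in T(y)$. A set-valued mapping $\Psi:\mathcal H\rightrightarrows\mathcal H'$ is metrically subregular at $\hat y\in\mathcal{H}$ for $\hat z\in\Psi(\hat y)$ if there exist $\delta>0$ and $\kappa>0$ such that $\kappa\operatorname{dist}(y,\Psi^{-1}(\hat z))\le\operatorname{dist}(\hat z,\Psi(y))$ for all $y$ in the open ball $\mathbb{B}_\delta(\hat y)$, where $\Psi^{-1}(\hat z)=\{y : \hat z\in\Psi(y)\}$. "Converges linearly to $\tilde y$" is understood as: there exist $C\ge0$ and $c\in[0,1)$ with $\|y^{(k)}-\tilde y\|\le Cc^k$ for all $k$. *)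

theory Defs
  imports "HOL-Analysis.Analysis"
begin

definition adjoint_matrix :: "complex ^ 'n ^ 'm \<Rightarrow> complex ^ 'm ^ 'n" where
  "adjoint_matrix A = (\<chi> i j. cnj (A $ j $ i))"

definition unitary_matrix :: "complex ^ 'n ^ 'n \<Rightarrow> bool" where
  "unitary_matrix U \<longleftrightarrow> adjoint_matrix U ** U = mat 1 \<and> U ** adjoint_matrix U = mat 1"

(* The finite index type carries no order, so the position of each index is given
   by an enumeration e, intended to be a bijection onto {0, ..., n - 1}. *)
definition dft_matrix :: "('n \<Rightarrow> nat) \<Rightarrow> complex ^ 'n ^ 'n" where
  "dft_matrix e = (\<chi> j k. exp (- 2 * complex_of_real pi * \<i> * of_nat (e j) * of_nat (e k)
     / of_nat CARD('n)) / complex_of_real (sqrt (real CARD('n))))"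

(* The row index (j, k) denotes row k of the j-th block F D_j of the stacked matrix,
   so the rows are indexed by a type with m n elements. *)
definition propagation_matrix ::
    "complex ^ 'n ^ 'n \<Rightarrow> ('m::finite \<Rightarrow> complex ^ 'n ^ 'n) \<Rightarrow> complex ^ 'n ^ ('m \<times> 'n)" where
  "propagation_matrix F D =
     (\<chi> jk. complex_of_real (1 / sqrt (real CARD('m))) *s ((F ** D (fst jk)) $ snd jk))"

definition projector :: "'a::metric_space set \<Rightarrow> 'a \<Rightarrow> 'a set" where
  "projector S x = {w \<in> S. dist x w = infdist x S}"

definition drap ::
    "real \<Rightarrow> 'a::real_normed_vector set \<Rightarrow> 'a set \<Rightarrow> 'a \<Rightarrow> 'a set" where
  "drap l A B y = {p - l *\<^sub>R (b - y) | b p.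
     b \<in> projector B y \<and> p \<in> projector A ((1 + l) *\<^sub>R b - l *\<^sub>R y)}"

(* The distance to the empty set is meant to be infinite, whereas infdist z {} = 0;
   hence the inequality is only required where Psi y is nonempty. *)
definition metrically_subregular ::
    "('a::metric_space \<Rightarrow> 'b::metric_space set) \<Rightarrow> 'a \<Rightarrow> 'b \<Rightarrow> bool" where
  "metrically_subregular Psi yh zh \<longleftrightarrow> zh \<in> Psi yh \<and>
     (\<exists>\<delta>>0. \<exists>\<kappa>>0. \<forall>y\<in>ball yh \<delta>. Psi y \<noteq> {} \<longrightarrow>
        \<kappa> * infdist y {x. zh \<in> Psi x} \<le> infdist zh (Psi y))"

definition converges_linearly_to :: "(nat \<Rightarrow> 'a::real_normed_vector) \<Rightarrow> 'a \<Rightarrow> bool" where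
  "converges_linearly_to y l \<longleftrightarrow>
     (\<exists>C\<ge>0. \<exists>c. 0 \<le> c \<and> c < 1 \<and> (\<forall>k. norm (y k - l) \<le> C * c ^ k))"

end

theory Submission
  imports Defs
begin

text \<open>
  Near \<open>yh\<close> the operator is almost averaged: for \<open>t \<in> T x\<close> and \<open>u \<in> T y\<close>,
  \<open>\<parallel>t - u\<parallel>\<^sup>2 + \<parallel>(x - t) - (y - u)\<parallel>\<^sup>2 / 2 \<le> (1 + \<epsilon>) \<parallel>x - y\<parallel>\<^sup>2\<close>, where \<open>\<epsilon>\<close> can be made as small
  as desired by shrinking the ball around \<open>yh\<close>. For a fixed point \<open>y = u\<close> the second term on the
  left is half the squared residual \<open>\<parallel>x - t\<parallel>\<^sup>2\<close>, and metric subregularity with constant \<open>\<kappa>\<close>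
  bounds this residual below by \<open>\<kappa>\<close> times the distance \<open>d\<close> of \<open>x\<close> to the fixed points. Choosing
  for \<open>y\<close> the fixed point nearest to \<open>x\<close> and \<open>\<epsilon> = \<kappa>\<^sup>2 / 4\<close>, the gain \<open>\<kappa>\<^sup>2 d\<^sup>2 / 2\<close> outweighs the
  loss \<open>\<epsilon> d\<^sup>2\<close>, so each step shrinks the distance to the fixed points by the factor
  \<open>q = sqrt (1 - \<kappa>\<^sup>2 / 4) < 1\<close>
  (\<open>almost_averaged_contracts_to_fixed_points\<close>). A step has length at most \<open>2 d\<close>, hence the steps
  decay geometrically: the iterates never leave the ball if they start close enough to \<open>yh\<close>, and
  they converge linearly (\<open>almost_averaged_subregular_linear_convergence\<close>).

  The almost averaged property has two ingredients. The projector onto the closed convex set \<open>A\<close> is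
  firmly nonexpansive. The set \<open>B\<close> is a product of circles, whose radial projection is firmly
  nonexpansive up to an error that vanishes at the circle
  (\<open>modulus_projector_almost_monotone\<close>). A Hilbert space computation combines the two
  (\<open>drap_almost_averaged\<close>). The propagation matrix is injective because the Fourier matrix and the
  phase diversities are invertible; this makes \<open>A\<close> closed.
\<close>

section \<open>Linear convergence of almost averaged operators\<close>

text \<open>The series of steps is dominated by a geometric one, and the error at time \<open>k\<close> is its tail.\<close>

lemma geometric_steps_converge:
  fixes y :: "nat \<Rightarrow> 'a::banach"
  assumes q: "0 \<le> q" "q < 1"
    and step: "\<And>k. norm (y (Suc k) - y k) \<le> C * q ^ k"
  obtains l where "y \<longlonglongrightarrow> l" "\<And>k. norm (y k - l) \<le> C / (1 - q) * q ^ k"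
proof -
  have "summable (\<lambda>k. C * q ^ k)" using q by (intro summable_mult summable_geometric) simp
  have tel: "norm (y (k + n) - y k) \<le> C / (1 - q) * q ^ k * (1 - q ^ n)" for k n
  proof (induction n)
    case (Suc n)
    have "norm (y (k + Suc n) - y k) \<le> norm (y (Suc (k + n)) - y (k + n)) + norm (y (k + n) - y k)"
      by (rule order_trans[OF eq_refl norm_triangle_ineq]) simp
    also have "\<dots> \<le> C * q ^ (k + n) + C / (1 - q) * q ^ k * (1 - q ^ n)"
      using Suc step by (intro add_mono) auto
    also have "\<dots> = C / (1 - q) * q ^ k * (1 - q ^ Suc n)"
      using q by (simp add: field_simps power_add)
    finally show ?case .
  qed simp
  have "0 \<le> C" using order_trans[OF norm_ge_zero step[of 0]] by simp
  have bound: "norm (y (k + n) - y k) \<le> C / (1 - q) * q ^ k" for k n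
    by (rule order_trans[OF tel], rule mult_left_le) (use q \<open>0 \<le> C\<close> in auto)
  have "summable (\<lambda>k. y (Suc k) - y k)"
    using \<open>summable (\<lambda>k. C * q ^ k)\<close> by (rule summable_comparison_test') (rule step)
  then have "convergent (\<lambda>n. \<Sum>k<n. y (Suc k) - y k)"
    by (simp add: summable_iff_convergent)
  then have "convergent (\<lambda>n. y n - y 0)" by (simp add: sum_lessThan_telescope)
  then obtain l where l: "y \<longlonglongrightarrow> l"
    by (metis convergent_def convergent_diff_const_right_iff)
  have "norm (y k - l) \<le> C / (1 - q) * q ^ k" for k
  proof (rule LIMSEQ_le_const2)
    show "(\<lambda>n. norm (y k - y (n + k))) \<longlonglongrightarrow> norm (y k - l)"
      by (intro tendsto_intros LIMSEQ_ignore_initial_segment l)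
    show "\<exists>N. \<forall>n\<ge>N. norm (y k - y (n + k)) \<le> C / (1 - q) * q ^ k"
      using bound[of k] by (metis add.commute norm_minus_commute)
  qed
  with l show thesis by (rule that)
qed

text \<open>
  For \<open>\<epsilon> = 0\<close> this is averagedness with constant \<open>2 / 3\<close>, the constant of the method of
  alternating projections.
\<close>

definition almost_averaged_on :: "'a::real_normed_vector set \<Rightarrow> real \<Rightarrow> ('a \<Rightarrow> 'a set) \<Rightarrow> bool" where
  "almost_averaged_on S \<epsilon> T \<longleftrightarrow> (\<forall>x\<in>S. \<forall>y\<in>S. \<forall>t\<in>T x. \<forall>u\<in>T y.
     (norm (t - u))\<^sup>2 + (norm ((x - t) - (y - u)))\<^sup>2 / 2 \<le> (1 + \<epsilon>) * (norm (x - y))\<^sup>2)"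

text \<open>
  Comparing the limit with fixed points converging to it forces each of its images to coincide with
  it. This lets nearest fixed points be attained and makes the limit of the iterates a fixed point.
\<close>

lemma almost_averaged_fixed_points_closed:
  fixes T :: "'a::real_normed_vector \<Rightarrow> 'a set"
  assumes avg: "almost_averaged_on S \<epsilon> T" and "open S"
    and z: "z \<in> closure {x. x \<in> T x}" "z \<in> S" and "T z \<noteq> {}"
  shows "z \<in> T z"
proof -
  obtain t where t: "t \<in> T z" using \<open>T z \<noteq> {}\<close> by blast
  obtain w where w: "\<And>n. w n \<in> {x. x \<in> T x}" "w \<longlonglongrightarrow> z"
    using z(1) unfolding closure_sequential by blast
  have "\<forall>\<^sub>F n in sequentially. w n \<in> S"
    using w(2) \<open>open S\<close> z(2) by (rule topological_tendstoD)
  then have "\<forall>\<^sub>F n in sequentially. (norm (w n - t))\<^sup>2 \<le> (1 + \<epsilon>) * (norm (w n - z))\<^sup>2"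
  proof eventually_elim
    case (elim n)
    have "(norm (w n - t))\<^sup>2 + (norm ((w n - w n) - (z - t)))\<^sup>2 / 2 \<le> (1 + \<epsilon>) * (norm (w n - z))\<^sup>2"
      using avg elim z(2) w(1)[of n] t unfolding almost_averaged_on_def by blast
    then show ?case by (smt (verit) divide_nonneg_pos zero_le_power2)
  qed
  moreover have "(\<lambda>n. (norm (w n - t))\<^sup>2) \<longlonglongrightarrow> (norm (z - t))\<^sup>2"
    by (intro tendsto_intros w(2))
  moreover have "(\<lambda>n. (1 + \<epsilon>) * (norm (w n - z))\<^sup>2) \<longlonglongrightarrow> (1 + \<epsilon>) * (norm (z - z))\<^sup>2"
    by (intro tendsto_intros w(2))
  ultimately have "(norm (z - t))\<^sup>2 \<le> (1 + \<epsilon>) * (norm (z - z))\<^sup>2"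
    by (intro tendsto_le[OF sequentially_bot])
  then show ?thesis using t by simp
qed

text \<open>
  Almost averagedness against the fixed point \<open>z\<close> nearest to \<open>x\<close> gives
  \<open>\<parallel>t - z\<parallel>\<^sup>2 \<le> (1 + \<kappa>\<^sup>2 / 4) d\<^sup>2 - \<parallel>t - x\<parallel>\<^sup>2 / 2\<close> with \<open>d = \<parallel>x - z\<parallel>\<close>, and the error bound turns the last
  term into at least \<open>\<kappa>\<^sup>2 d\<^sup>2 / 2\<close>. The point \<open>x\<close> has to lie in the ball of half the radius, so
  that \<open>z\<close>, which is at most as far from \<open>x\<close> as \<open>a\<close> is, lies in the ball of radius \<open>R\<close>.
\<close>

lemma almost_averaged_contracts_to_fixed_points:
  fixes T :: "'a::euclidean_space \<Rightarrow> 'a set"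
  assumes avg: "almost_averaged_on (ball a R) (\<kappa>\<^sup>2 / 4) T"
    and nonempty: "\<And>x. T x \<noteq> {}" and fix_a: "a \<in> T a"
    and \<kappa>: "0 < \<kappa>" "\<kappa> \<le> 1"
    and error: "\<kappa> * infdist x {z. z \<in> T z} \<le> norm (t - x)"
    and x: "x \<in> ball a (R / 2)" and t: "t \<in> T x"
  shows "infdist t {z. z \<in> T z} \<le> sqrt (1 - \<kappa>\<^sup>2 / 4) * infdist x {z. z \<in> T z}"
    and "norm (t - x) \<le> 2 * infdist x {z. z \<in> T z}"
proof -
  let ?F = "{z. z \<in> T z}"
  define d where "d = infdist x ?F"
  have "0 \<le> d" by (simp add: d_def infdist_nonneg)
  \<comment> \<open>A nearest point of the closure exists, and it turns out to be a fixed point.\<close>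
  have "closure ?F \<noteq> {}" using fix_a by (auto simp: closure_eq_empty)
  then obtain z where z: "z \<in> closure ?F" "infdist x (closure ?F) = dist x z"
    using infdist_attains_inf[OF closed_closure] by metis
  then have dz: "d = norm (x - z)" by (simp add: d_def dist_norm infdist_eq_setdist)
  have "d \<le> dist x a" unfolding d_def using fix_a by (intro infdist_le) simp
  then have "dist a z \<le> 2 * dist a x"
    using dz dist_triangle[of a z x] by (simp add: dist_norm norm_minus_commute)
  with x have z_ball: "z \<in> ball a R" by simp
  have zfix: "z \<in> T z"
    using almost_averaged_fixed_points_closed[OF avg open_ball z(1) z_ball nonempty] .
  have x_ball: "x \<in> ball a R" using x by (simp, smt (verit) field_sum_of_halves zero_le_dist)
  have "(norm (t - z))\<^sup>2 + (norm ((x - t) - (z - z)))\<^sup>2 / 2 \<le> (1 + \<kappa>\<^sup>2 / 4) * (norm (x - z))\<^sup>2"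
    using avg x_ball z_ball t zfix unfolding almost_averaged_on_def by blast
  then have "(norm (t - z))\<^sup>2 + (norm (t - x))\<^sup>2 / 2 \<le> (1 + \<kappa>\<^sup>2 / 4) * d\<^sup>2"
    by (simp add: dz norm_minus_commute)
  moreover have "(\<kappa> * d)\<^sup>2 \<le> (norm (t - x))\<^sup>2"
    using error \<kappa> \<open>0 \<le> d\<close> by (intro power_mono) (auto simp: d_def)
  ultimately have "(norm (t - z))\<^sup>2 \<le> (1 - \<kappa>\<^sup>2 / 4) * d\<^sup>2"
    by (simp add: power_mult_distrib algebra_simps)
  then have tz: "norm (t - z) \<le> sqrt (1 - \<kappa>\<^sup>2 / 4) * d"
    using \<open>0 \<le> d\<close> by (metis real_le_rsqrt real_sqrt_mult real_sqrt_unique)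
  have "infdist t ?F \<le> norm (t - z)"
    using infdist_le[of z ?F t] zfix by (simp add: dist_norm)
  with tz show "infdist t ?F \<le> sqrt (1 - \<kappa>\<^sup>2 / 4) * infdist x ?F"
    by (simp add: d_def)
  have "sqrt (1 - \<kappa>\<^sup>2 / 4) \<le> 1" using \<kappa> by simp
  then have "norm (t - z) \<le> d"
    using tz mult_right_mono[of "sqrt (1 - \<kappa>\<^sup>2 / 4)" 1 d] \<open>0 \<le> d\<close> by linarith
  moreover have "norm (t - x) \<le> norm (t - z) + norm (x - z)"
    by (metis dist_norm dist_triangle2)
  ultimately show "norm (t - x) \<le> 2 * infdist x ?F" using dz by (simp add: d_def)
qed

text \<open>
  The distance to the fixed points decays like \<open>q ^ k\<close> and the steps are at most twice this distance,
  as long as the iterates stay in the ball of radius \<open>\<rho>\<close> on which both hypotheses apply. They do stay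
  there, because the total length \<open>2 d / (1 - q)\<close> of all steps is proportional to the initial distance
  \<open>d\<close>.
\<close>

theorem almost_averaged_subregular_linear_convergence:
  fixes T :: "'a::euclidean_space \<Rightarrow> 'a set"
  assumes avg: "\<And>\<epsilon>. 0 < \<epsilon> \<Longrightarrow> \<exists>R>0. almost_averaged_on (ball a R) \<epsilon> T"
    and nonempty: "\<And>x. T x \<noteq> {}" and fix_a: "a \<in> T a"
    and subreg: "metrically_subregular (\<lambda>x. (\<lambda>t. t - x) ` T x) a 0"
  shows "\<exists>\<epsilon>>0. \<forall>y. y 0 \<in> ball a \<epsilon> \<and> (\<forall>k. y (Suc k) \<in> T (y k)) \<longrightarrow>
           (\<exists>l. l \<in> T l \<and> converges_linearly_to y l)"
proof -
  let ?F = "{z. z \<in> T z}"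
  obtain \<delta> \<kappa>' where \<delta>: "\<delta> > 0" and \<kappa>': "\<kappa>' > 0" and
    sub: "\<And>x. x \<in> ball a \<delta> \<Longrightarrow> \<kappa>' * infdist x {x. 0 \<in> (\<lambda>t. t - x) ` T x} \<le> infdist 0 ((\<lambda>t. t - x) ` T x)"
    using subreg nonempty unfolding metrically_subregular_def by (auto)
  \<comment> \<open>Lowering the constant to at most 1 makes the radicand in the contraction factor nonnegative.\<close>
  define \<kappa> where "\<kappa> = min \<kappa>' 1"
  have \<kappa>: "0 < \<kappa>" "\<kappa> \<le> 1" using \<kappa>' by (auto simp: \<kappa>_def)
  have F_eq: "{x. 0 \<in> (\<lambda>t. t - x) ` T x} = ?F" by auto
  have error: "\<kappa> * infdist x ?F \<le> norm (t - x)" if "x \<in> ball a \<delta>" "t \<in> T x" for x t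
  proof -
    have "\<kappa> * infdist x ?F \<le> \<kappa>' * infdist x ?F"
      by (intro mult_right_mono infdist_nonneg) (simp add: \<kappa>_def)
    also have "\<dots> \<le> infdist 0 ((\<lambda>t. t - x) ` T x)" using sub[OF that(1)] F_eq by simp
    also have "\<dots> \<le> dist 0 (t - x)" using that(2) by (intro infdist_le) simp
    finally show ?thesis by simp
  qed
  obtain R where R: "R > 0" and avgR: "almost_averaged_on (ball a R) (\<kappa>\<^sup>2 / 4) T"
    using avg[of "\<kappa>\<^sup>2 / 4"] \<kappa> by auto
  define q where "q = sqrt (1 - \<kappa>\<^sup>2 / 4)"
  have "\<kappa>\<^sup>2 \<le> 1" using \<kappa> by (simp add: power_le_one)
  then have q: "0 \<le> q" "q < 1" using \<kappa> by (auto simp: q_def)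
  define \<rho> where "\<rho> = min \<delta> (R / 2)"
  \<comment> \<open>The initial offset and the total length of the steps together must stay below \<open>\<rho>\<close>.\<close>
  define \<epsilon> where "\<epsilon> = \<rho> / (1 + 2 / (1 - q))"
  have "\<rho> > 0" using \<delta> R by (simp add: \<rho>_def)
  have den: "1 + 2 / (1 - q) > 0" using q by (simp add: add_pos_pos)
  have "\<epsilon> > 0" using \<open>\<rho> > 0\<close> den by (simp add: \<epsilon>_def)
  have \<epsilon>\<rho>: "\<epsilon> + 2 * \<epsilon> / (1 - q) = \<rho>"
  proof -
    have "\<epsilon> + 2 * \<epsilon> / (1 - q) = \<epsilon> * (1 + 2 / (1 - q))" by (simp add: distrib_left)
    also have "\<dots> = \<rho>" unfolding \<epsilon>_def
      by (rule nonzero_eq_divide_eq[THEN iffD1, OF _ refl]) (use den in linarith)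
    finally show ?thesis .
  qed
  have step: "infdist t ?F \<le> q * infdist x ?F" "norm (t - x) \<le> 2 * infdist x ?F"
    if "x \<in> ball a \<rho>" "t \<in> T x" for x t
  proof -
    have x: "x \<in> ball a \<delta>" "x \<in> ball a (R / 2)" using that(1) by (auto simp: \<rho>_def)
    show "infdist t ?F \<le> q * infdist x ?F" "norm (t - x) \<le> 2 * infdist x ?F"
      using almost_averaged_contracts_to_fixed_points
        [OF avgR nonempty fix_a \<kappa> error[OF x(1) that(2)] x(2) that(2)]
      unfolding q_def by auto
  qed
  have "\<exists>l. l \<in> T l \<and> converges_linearly_to y l"
    if y0: "y 0 \<in> ball a \<epsilon>" and y: "\<And>k. y (Suc k) \<in> T (y k)" for y
  proof -
    define d where "d = infdist (y 0) ?F"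
    have "d \<le> dist (y 0) a" unfolding d_def using fix_a by (intro infdist_le) simp
    then have d: "0 \<le> d" "d < \<epsilon>" using y0 by (auto simp: d_def infdist_nonneg dist_commute)
    have near: "x \<in> ball a \<rho>" if "norm (x - y 0) \<le> 2 * d / (1 - q)" for x
    proof -
      have "2 * d / (1 - q) \<le> 2 * \<epsilon> / (1 - q)" using d q by (intro divide_right_mono) auto
      moreover have "dist a x \<le> dist a (y 0) + norm (x - y 0)"
        by (metis dist_norm dist_triangle norm_minus_commute)
      ultimately show ?thesis using that y0 \<epsilon>\<rho> by simp
    qed
    have inv: "norm (y k - y 0) \<le> 2 * d / (1 - q) * (1 - q ^ k) \<and> infdist (y k) ?F \<le> d * q ^ k" for k
    proof (induction k)
      case (Suc k)
      have "2 * d / (1 - q) * (1 - q ^ k) \<le> 2 * d / (1 - q)"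
        using q d by (intro mult_left_le) auto
      then have ball: "y k \<in> ball a \<rho>" using Suc by (intro near) linarith
      have "norm (y (Suc k) - y 0) \<le> norm (y (Suc k) - y k) + norm (y k - y 0)"
        by (rule order_trans[OF eq_refl norm_triangle_ineq]) simp
      also have "\<dots> \<le> 2 * (d * q ^ k) + 2 * d / (1 - q) * (1 - q ^ k)"
        using step(2)[OF ball y] Suc by linarith
      also have "\<dots> = 2 * d / (1 - q) * (1 - q ^ Suc k)"
        using q by (simp add: field_simps)
      finally have "norm (y (Suc k) - y 0) \<le> 2 * d / (1 - q) * (1 - q ^ Suc k)" .
      moreover have "infdist (y (Suc k)) ?F \<le> q * (d * q ^ k)"
        using step(1)[OF ball y] mult_left_mono[OF conjunct2[OF Suc] q(1)] by (rule order_trans)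
      ultimately show ?case by (simp add: mult_ac)
    qed (simp add: d_def)
    have ball: "y k \<in> ball a \<rho>" for k
    proof (rule near)
      have "2 * d / (1 - q) * (1 - q ^ k) \<le> 2 * d / (1 - q)"
        using q d by (intro mult_left_le) auto
      then show "norm (y k - y 0) \<le> 2 * d / (1 - q)" using inv[of k] by linarith
    qed
    have "norm (y (Suc k) - y k) \<le> 2 * d * q ^ k" for k
      using step(2)[OF ball y, of k] inv[of k] by simp
    from geometric_steps_converge[OF q this]
    obtain l where l: "y \<longlonglongrightarrow> l" "\<And>k. norm (y k - l) \<le> 2 * d / (1 - q) * q ^ k" by blast
    have "(\<lambda>k. infdist (y k) ?F) \<longlonglongrightarrow> infdist l ?F"
      by (intro tendsto_intros l)
    moreover have "(\<lambda>k. d * q ^ k) \<longlonglongrightarrow> d * 0"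
      using q by (intro tendsto_intros LIMSEQ_power_zero) auto
    ultimately have "infdist l ?F \<le> 0"
      using inv by (intro LIMSEQ_le[of _ _ "\<lambda>k. d * q ^ k"]) auto
    then have "l \<in> closure ?F"
      using fix_a infdist_nonneg[of l ?F] by (subst in_closure_iff_infdist_zero) auto
    moreover have "l \<in> ball a R"
    proof -
      have "l \<in> ball a \<rho>"
        by (rule near) (use l(2)[of 0] in \<open>simp add: norm_minus_commute\<close>)
      then show ?thesis using R by (auto simp: \<rho>_def)
    qed
    ultimately have "l \<in> T l"
      using almost_averaged_fixed_points_closed[OF avgR open_ball] nonempty by blast
    moreover have "converges_linearly_to y l"
      unfolding converges_linearly_to_def
      using l(2) q d by (intro exI[of _ "2 * d / (1 - q)"] conjI exI[of _ q]) auto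
    ultimately show ?thesis by blast
  qed
  with \<open>\<epsilon> > 0\<close> show ?thesis by blast
qed

section \<open>From the projectors to the DRAP operator\<close>

lemma projector_nonempty:
  fixes x :: "'a::heine_borel"
  assumes "closed S" "S \<noteq> {}"
  shows "projector S x \<noteq> {}"
proof -
  obtain w where "w \<in> S" "infdist x S = dist x w"
    using infdist_attains_inf[OF assms] by blast
  then show ?thesis unfolding projector_def by force
qed

lemma projector_self: "x \<in> S \<Longrightarrow> x \<in> projector S x"
  by (simp add: projector_def)

text \<open>The obtuse angle criterion at each of the two projections, tested with the other one, adds up to
  firm nonexpansiveness.\<close>

lemma projector_convex_firmly_nonexpansive:
  fixes A :: "'a::euclidean_space set"
  assumes "closed A" "convex A"
    and p: "p \<in> projector A u" and p': "p' \<in> projector A u'"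
  shows "(norm (p - p'))\<^sup>2 \<le> (p - p') \<bullet> (u - u')"
proof -
  have var: "(v - w) \<bullet> (z - w) \<le> 0" if "w \<in> projector A v" "z \<in> A" for v w z
    using that assms(1,2)
    by (intro any_closest_point_dot[of A]) (auto simp: projector_def infdist_le)
  have "(u - p) \<bullet> (p' - p) + (u' - p') \<bullet> (p - p') \<le> 0"
    using var[OF p, of p'] var[OF p', of p] p p' by (simp add: projector_def)
  then show ?thesis
    by (simp add: power2_norm_eq_inner inner_simps inner_commute algebra_simps)
qed

text \<open>
  Put \<open>s = x - y\<close>, let \<open>\<beta>\<close> and \<open>\<pi>\<close> be the differences of the two projections onto \<open>B\<close> and \<open>A\<close>, and
  \<open>g = s - \<beta>\<close>. Then the arguments of the second projection differ by \<open>\<beta> - l g\<close>, the images differ by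
  \<open>\<pi> + l g\<close> and the residuals by \<open>(\<beta> - \<pi>) + (1 - l) g\<close>. Firm nonexpansiveness on \<open>A\<close> yields
  \<open>\<parallel>\<pi> + l g\<parallel>\<^sup>2 \<le> \<parallel>\<beta>\<parallel>\<^sup>2 - \<parallel>\<beta> - \<pi>\<parallel>\<^sup>2 + l\<^sup>2 \<parallel>g\<parallel>\<^sup>2\<close>. Expanding \<open>\<parallel>s\<parallel>\<^sup>2 = \<parallel>\<beta> + g\<parallel>\<^sup>2\<close> leaves the surplus
  \<open>\<parallel>\<beta> - \<pi>\<parallel>\<^sup>2 + (1 - l\<^sup>2) \<parallel>g\<parallel>\<^sup>2\<close>, which dominates half the squared residual difference because
  \<open>(1 - l)\<^sup>2 \<le> 1 - l\<^sup>2\<close>. The cross term \<open>2 (\<beta> \<bullet> g)\<close> would be nonnegative for a convex set \<open>B\<close>;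
  here it costs at most \<open>\<epsilon> \<parallel>s\<parallel>\<^sup>2\<close>.
\<close>

lemma drap_almost_averaged:
  fixes A B :: "'a::euclidean_space set"
  assumes l: "0 \<le> l" "l \<le> 1" and A: "closed A" "convex A"
    and mono: "\<And>x y b b'. x \<in> S \<Longrightarrow> y \<in> S \<Longrightarrow> b \<in> projector B x \<Longrightarrow> b' \<in> projector B y \<Longrightarrow>
      (b - b') \<bullet> ((x - y) - (b - b')) \<ge> - (\<epsilon> / 2) * (norm (x - y))\<^sup>2"
  shows "almost_averaged_on S \<epsilon> (drap l A B)"
  unfolding almost_averaged_on_def
proof (intro ballI)
  fix x y t u assume xy: "x \<in> S" "y \<in> S" and t: "t \<in> drap l A B x" and u: "u \<in> drap l A B y"
  obtain b p where bp: "t = p - l *\<^sub>R (b - x)" "b \<in> projector B x"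
    "p \<in> projector A ((1 + l) *\<^sub>R b - l *\<^sub>R x)" using t unfolding drap_def by blast
  obtain b' p' where bp': "u = p' - l *\<^sub>R (b' - y)" "b' \<in> projector B y"
    "p' \<in> projector A ((1 + l) *\<^sub>R b' - l *\<^sub>R y)" using u unfolding drap_def by blast
  define \<beta> \<pi> g where "\<beta> = b - b'" and "\<pi> = p - p'" and "g = (x - y) - \<beta>"
  have s: "x - y = \<beta> + g" by (simp add: g_def)
  have tu: "t - u = \<pi> + l *\<^sub>R g"
    unfolding bp(1) bp'(1) g_def \<beta>_def \<pi>_def by (simp add: algebra_simps)
  have res: "(x - t) - (y - u) = (\<beta> - \<pi>) + (1 - l) *\<^sub>R g"
  proof -
    have "(x - t) - (y - u) = (x - y) - (t - u)" by simp
    then show ?thesis unfolding s tu by (simp add: algebra_simps)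
  qed
  have "(norm \<pi>)\<^sup>2 \<le> \<pi> \<bullet> (((1 + l) *\<^sub>R b - l *\<^sub>R x) - ((1 + l) *\<^sub>R b' - l *\<^sub>R y))"
    unfolding \<pi>_def by (rule projector_convex_firmly_nonexpansive[OF A bp(3) bp'(3)])
  also have "((1 + l) *\<^sub>R b - l *\<^sub>R x) - ((1 + l) *\<^sub>R b' - l *\<^sub>R y) = \<beta> - l *\<^sub>R g"
    unfolding g_def \<beta>_def by (simp add: algebra_simps)
  finally have firm: "(norm \<pi>)\<^sup>2 \<le> \<pi> \<bullet> \<beta> - l * (\<pi> \<bullet> g)" by (simp add: inner_simps)
  have "(norm (t - u))\<^sup>2 = (norm \<pi>)\<^sup>2 + 2 * (l * (\<pi> \<bullet> g)) + l\<^sup>2 * (norm g)\<^sup>2"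
    unfolding tu power2_norm_eq_inner by (simp add: inner_simps inner_commute power2_eq_square)
  also have "\<dots> \<le> (norm \<beta>)\<^sup>2 - (norm (\<beta> - \<pi>))\<^sup>2 + l\<^sup>2 * (norm g)\<^sup>2"
    using firm by (simp add: power2_norm_eq_inner inner_simps inner_commute)
  finally have 1: "(norm (t - u))\<^sup>2 \<le> (norm \<beta>)\<^sup>2 - (norm (\<beta> - \<pi>))\<^sup>2 + l\<^sup>2 * (norm g)\<^sup>2" .
  have "(norm (x - y))\<^sup>2 = (norm \<beta>)\<^sup>2 + 2 * (\<beta> \<bullet> g) + (norm g)\<^sup>2"
    unfolding s by (simp add: power2_norm_eq_inner inner_simps inner_commute)
  moreover have "\<beta> \<bullet> g \<ge> - (\<epsilon> / 2) * (norm (x - y))\<^sup>2"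
    using mono[OF xy bp(2) bp'(2)] by (simp add: \<beta>_def g_def)
  ultimately have 2: "(norm \<beta>)\<^sup>2 \<le> (1 + \<epsilon>) * (norm (x - y))\<^sup>2 - (norm g)\<^sup>2"
    by (simp add: algebra_simps)
  have par: "(norm (v + w))\<^sup>2 \<le> 2 * (norm v)\<^sup>2 + 2 * (norm w)\<^sup>2" for v w :: 'a
    using zero_le_power2[of "norm (v - w)"]
    by (simp add: power2_norm_eq_inner inner_simps inner_commute)
  have "(1 - l)\<^sup>2 \<le> 1 - l\<^sup>2"
    using l mult_left_mono[of l 1 l] by (simp add: power2_eq_square algebra_simps)
  then have "(1 - l)\<^sup>2 * (norm g)\<^sup>2 \<le> (1 - l\<^sup>2) * (norm g)\<^sup>2"
    by (intro mult_right_mono) auto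
  then have 3: "(norm ((x - t) - (y - u)))\<^sup>2 / 2 \<le> (norm (\<beta> - \<pi>))\<^sup>2 + (1 - l\<^sup>2) * (norm g)\<^sup>2"
    unfolding res using par[of "\<beta> - \<pi>" "(1 - l) *\<^sub>R g"] l by (simp add: power_mult_distrib)
  show "(norm (t - u))\<^sup>2 + (norm ((x - t) - (y - u)))\<^sup>2 / 2 \<le> (1 + \<epsilon>) * (norm (x - y))\<^sup>2"
    using 1 2 3 by (simp add: algebra_simps)
qed

section \<open>The projector onto the modulus constraint\<close>

lemma closed_modulus_constraint:
  fixes r :: "real ^ 'i::finite"
  shows "closed {y :: complex ^ 'i. \<forall>i. (cmod (y $ i))\<^sup>2 = r $ i}"
  by (intro closed_Collect_all closed_Collect_eq continuous_intros)

text \<open>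
  Since \<open>B\<close> is a product, a nearest point is nearest in each coordinate: rotating a single coordinate of
  \<open>b\<close> to the direction of \<open>y $ i\<close> stays in \<open>B\<close>, hence cannot shorten the distance, and equality in the
  Cauchy-Schwarz inequality aligns \<open>b $ i\<close> with \<open>y $ i\<close>. The equation is stated without division,
  so that it also covers \<open>y $ i = 0\<close>, where every point of the circle is nearest.
\<close>

lemma modulus_projector_aligned:
  fixes y b :: "complex ^ 'i::finite" and r :: "real ^ 'i"
  assumes b: "b \<in> projector {y. \<forall>i. (cmod (y $ i))\<^sup>2 = r $ i} y"
  shows "cmod (y $ i) *\<^sub>R b $ i = sqrt (r $ i) *\<^sub>R y $ i" and "cmod (b $ i) = sqrt (r $ i)"
proof -
  let ?B = "{y. \<forall>i. (cmod (y $ i))\<^sup>2 = r $ i}"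
  have bB: "(cmod (b $ j))\<^sup>2 = r $ j" for j
    using b by (simp add: projector_def)
  have best: "dist y b \<le> dist y c" if "c \<in> ?B" for c
    using b infdist_le[OF that, of y] by (simp add: projector_def)
  show bi: "cmod (b $ i) = sqrt (r $ i)"
    unfolding bB[of i, symmetric] by simp
  show "cmod (y $ i) *\<^sub>R b $ i = sqrt (r $ i) *\<^sub>R y $ i"
  proof (cases "y $ i = 0")
    case False
    define c where "c = (\<chi> j. if j = i then sqrt (r $ i) *\<^sub>R sgn (y $ i) else b $ j)"
    have r0: "0 \<le> r $ i" unfolding bB[of i, symmetric] by simp
    have ci: "cmod (c $ i) = sqrt (r $ i)" using False r0 by (simp add: c_def norm_sgn)
    have "(cmod (c $ j))\<^sup>2 = r $ j" for j
    proof (cases "j = i")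
      case True
      then show ?thesis using ci r0 by simp
    next
      case False
      then show ?thesis using bB by (simp add: c_def)
    qed
    then have "c \<in> ?B" by simp
    then have "(norm (y - b))\<^sup>2 \<le> (norm (y - c))\<^sup>2"
      using best by (simp add: dist_norm)
    moreover have "(norm (y - v))\<^sup>2 =
        (cmod (y $ i - v $ i))\<^sup>2 + (\<Sum>j\<in>-{i}. (cmod (y $ j - v $ j))\<^sup>2)" for v :: "complex ^ 'i"
    proof -
      have "(norm (y - v))\<^sup>2 = (\<Sum>j\<in>UNIV. (cmod (y $ j - v $ j))\<^sup>2)"
        by (simp add: norm_vec_def L2_set_def sum_nonneg)
      also have "\<dots> = (cmod (y $ i - v $ i))\<^sup>2 + (\<Sum>j\<in>UNIV - {i}. (cmod (y $ j - v $ j))\<^sup>2)"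
        by (rule sum.remove) auto
      finally show ?thesis by (simp add: Compl_eq_Diff_UNIV)
    qed
    moreover have "(\<Sum>j\<in>-{i}. (cmod (y $ j - c $ j))\<^sup>2) = (\<Sum>j\<in>-{i}. (cmod (y $ j - b $ j))\<^sup>2)"
      by (intro sum.cong) (auto simp: c_def)
    ultimately have "(cmod (y $ i - b $ i))\<^sup>2 \<le> (cmod (y $ i - c $ i))\<^sup>2" by simp
    moreover have "(cmod (u - v))\<^sup>2 = (cmod u)\<^sup>2 + (cmod v)\<^sup>2 - 2 * (u \<bullet> v)" for u v
      unfolding power2_norm_eq_inner by (simp add: inner_simps inner_commute)
    ultimately have "y $ i \<bullet> c $ i \<le> y $ i \<bullet> b $ i" using bi ci by simp
    moreover have "y $ i \<bullet> c $ i = cmod (y $ i) * sqrt (r $ i)"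
      using False by (simp add: c_def sgn_div_norm power2_norm_eq_inner[symmetric] power2_eq_square)
    ultimately have "y $ i \<bullet> b $ i = cmod (y $ i) * cmod (b $ i)"
      using bi norm_cauchy_schwarz[of "y $ i" "b $ i"] by simp
    then show ?thesis unfolding bi[symmetric] by (simp only: norm_cauchy_schwarz_eq)
  qed simp
qed

text \<open>
  Write \<open>x = \<alpha> b\<close> and \<open>y = \<alpha>' b'\<close> with \<open>\<alpha>, \<alpha>' \<ge> 1 - \<delta>\<close>. Because \<open>b\<close> and \<open>b'\<close> have equal length,
  \<open>(b - b') \<bullet> (x - y) = (\<alpha> + \<alpha>') / 2 \<parallel>b - b'\<parallel>\<^sup>2\<close>. So the monotonicity defect is at most
  \<open>\<delta> \<parallel>b - b'\<parallel>\<^sup>2\<close>, and the same identity shows \<open>\<parallel>b - b'\<parallel> \<le> 2 \<parallel>x - y\<parallel>\<close>.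
\<close>

lemma circle_projection_almost_monotone:
  fixes x y b b' :: complex
  assumes \<rho>: "0 < \<rho>" and \<delta>: "0 \<le> \<delta>" "\<delta> \<le> 1 / 2"
    and b: "cmod b = \<rho>" "cmod x *\<^sub>R b = \<rho> *\<^sub>R x" "(1 - \<delta>) * \<rho> \<le> cmod x"
    and b': "cmod b' = \<rho>" "cmod y *\<^sub>R b' = \<rho> *\<^sub>R y" "(1 - \<delta>) * \<rho> \<le> cmod y"
  shows "(b - b') \<bullet> ((x - y) - (b - b')) \<ge> - (4 * \<delta>) * (norm (x - y))\<^sup>2"
proof -
  define \<alpha> \<alpha>' where "\<alpha> = cmod x / \<rho>" and "\<alpha>' = cmod y / \<rho>"
  have \<alpha>: "1 - \<delta> \<le> \<alpha>" "1 - \<delta> \<le> \<alpha>'" using b b' \<rho> by (auto simp: \<alpha>_def \<alpha>'_def field_simps)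
  have "\<rho> *\<^sub>R x = \<rho> *\<^sub>R (\<alpha> *\<^sub>R b)" "\<rho> *\<^sub>R y = \<rho> *\<^sub>R (\<alpha>' *\<^sub>R b')"
    using b(2) b'(2) \<rho> by (auto simp: \<alpha>_def \<alpha>'_def)
  then have x: "x = \<alpha> *\<^sub>R b" and y: "y = \<alpha>' *\<^sub>R b'" using \<rho> by (metis less_irrefl scaleR_cancel_left)+
  have bb: "b \<bullet> b = \<rho>\<^sup>2" "b' \<bullet> b' = \<rho>\<^sup>2" using b b' by (simp_all flip: power2_norm_eq_inner)
  have eq: "(b - b') \<bullet> (x - y) = (\<alpha> + \<alpha>') / 2 * (norm (b - b'))\<^sup>2"
    unfolding x y by (simp add: power2_norm_eq_inner inner_simps inner_commute bb) (simp add: field_simps)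
  have low: "(1 - \<delta>) * (norm (b - b'))\<^sup>2 \<le> (b - b') \<bullet> (x - y)"
    unfolding eq using \<alpha> by (intro mult_right_mono) auto
  have "(norm (b - b'))\<^sup>2 \<le> 4 * (norm (x - y))\<^sup>2"
  proof (cases "b = b'")
    case False
    have "1 / 2 * (norm (b - b'))\<^sup>2 \<le> (1 - \<delta>) * (norm (b - b'))\<^sup>2"
      using \<delta> by (intro mult_right_mono) auto
    also note low
    also have "(b - b') \<bullet> (x - y) \<le> norm (b - b') * norm (x - y)" by (rule norm_cauchy_schwarz)
    finally have "norm (b - b') \<le> 2 * norm (x - y)" using False by (simp add: power2_eq_square)
    then have "(norm (b - b'))\<^sup>2 \<le> (2 * norm (x - y))\<^sup>2" by (intro power_mono) auto
    then show ?thesis by (simp add: power_mult_distrib)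
  qed simp
  from mult_left_mono[OF this \<delta>(1)]
  have "\<delta> * (norm (b - b'))\<^sup>2 \<le> 4 * \<delta> * (norm (x - y))\<^sup>2" by (simp add: mult_ac)
  moreover have "(b - b') \<bullet> ((x - y) - (b - b')) = (b - b') \<bullet> (x - y) - (norm (b - b'))\<^sup>2"
    by (simp add: power2_norm_eq_inner inner_diff_right)
  ultimately show ?thesis using low by (simp add: algebra_simps)
qed

text \<open>
  The defect is a sum over the coordinates. Close to a point of \<open>B\<close>, each coordinate with \<open>r $ i \<noteq> 0\<close> has
  modulus at least \<open>(1 - \<delta>) * sqrt (r $ i)\<close>; a coordinate with \<open>r $ i = 0\<close> is projected to the
  constant 0 and contributes no defect.
\<close>

lemma modulus_projector_almost_monotone:
  fixes r :: "real ^ 'i::finite" and a :: "complex ^ 'i"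
  defines "B \<equiv> {y :: complex ^ 'i. \<forall>i. (cmod (y $ i))\<^sup>2 = r $ i}"
  assumes a: "a \<in> B" and "0 < \<epsilon>"
  shows "\<exists>R>0. \<forall>x\<in>ball a R. \<forall>y\<in>ball a R. \<forall>b\<in>projector B x. \<forall>b'\<in>projector B y.
           (b - b') \<bullet> ((x - y) - (b - b')) \<ge> - \<epsilon> * (norm (x - y))\<^sup>2"
proof -
  define \<delta> where "\<delta> = min (1 / 2) (\<epsilon> / 4)"
  have \<delta>: "0 < \<delta>" "\<delta> \<le> 1 / 2" "4 * \<delta> \<le> \<epsilon>" using \<open>0 < \<epsilon>\<close> by (auto simp: \<delta>_def)
  have ai: "cmod (a $ i) = sqrt (r $ i)" for i
    using a unfolding B_def by (metis (mono_tags, lifting) mem_Collect_eq norm_ge_zero real_sqrt_unique)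
  define R where "R = Min (range (\<lambda>i. if r $ i = 0 then 1 else \<delta> * sqrt (r $ i)))"
  have r0: "0 \<le> r $ i" for i using ai[of i] by (metis norm_ge_zero real_sqrt_ge_0_iff)
  have "R > 0" unfolding R_def using \<delta> r0 by (subst Min_gr_iff) (auto simp: less_le)
  have Ri: "R \<le> \<delta> * sqrt (r $ i)" if "r $ i \<noteq> 0" for i
    unfolding R_def using that by (intro Min_le) (auto intro!: range_eqI[of _ _ i])
  have large: "(1 - \<delta>) * sqrt (r $ i) \<le> cmod (x $ i)" if "x \<in> ball a R" "r $ i \<noteq> 0" for x i
  proof -
    have "cmod (a $ i) \<le> cmod (x $ i) + cmod ((a - x) $ i)"
      using norm_triangle_ineq[of "x $ i" "(a - x) $ i"] by simp
    also have "cmod ((a - x) $ i) \<le> norm (a - x)" by (rule Finite_Cartesian_Product.norm_nth_le)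
    finally show ?thesis using that Ri[OF that(2)] ai[of i] by (simp add: dist_norm algebra_simps)
  qed
  have "(b - b') \<bullet> ((x - y) - (b - b')) \<ge> - \<epsilon> * (norm (x - y))\<^sup>2"
    if "x \<in> ball a R" "y \<in> ball a R" "b \<in> projector B x" "b' \<in> projector B y" for x y b b'
  proof -
    note al = modulus_projector_aligned[OF that(3)[unfolded B_def]]
    note al' = modulus_projector_aligned[OF that(4)[unfolded B_def]]
    have comp: "- \<epsilon> * (norm ((x - y) $ i))\<^sup>2 \<le> (b - b') $ i \<bullet> ((x - y) - (b - b')) $ i" for i
    proof (cases "r $ i = 0")
      case True
      then have "b $ i = 0" "b' $ i = 0" using al(2)[of i] al'(2)[of i] by auto
      then show ?thesis using \<open>0 < \<epsilon>\<close> by simp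
    next
      case False
      then have "0 < sqrt (r $ i)" using r0[of i] by simp
      have "- \<epsilon> * (norm ((x - y) $ i))\<^sup>2 \<le> - (4 * \<delta>) * (norm ((x - y) $ i))\<^sup>2"
        using \<delta> by (intro mult_right_mono) auto
      also have "\<dots> \<le> (b - b') $ i \<bullet> ((x - y) - (b - b')) $ i"
        using circle_projection_almost_monotone[OF \<open>0 < sqrt (r $ i)\<close> less_imp_le[OF \<delta>(1)] \<delta>(2)
          al(2,1) large[OF that(1) False] al'(2,1) large[OF that(2) False]] by simp
      finally show ?thesis .
    qed
    have "(norm (x - y))\<^sup>2 = (\<Sum>i\<in>UNIV. (norm ((x - y) $ i))\<^sup>2)"
      by (simp add: norm_vec_def L2_set_def sum_nonneg)
    then have "- \<epsilon> * (norm (x - y))\<^sup>2 = (\<Sum>i\<in>UNIV. - \<epsilon> * (norm ((x - y) $ i))\<^sup>2)"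
      by (simp add: sum_distrib_left)
    also have "\<dots> \<le> (b - b') \<bullet> ((x - y) - (b - b'))"
      unfolding inner_vec_def by (intro sum_mono comp)
    finally show ?thesis .
  qed
  with \<open>R > 0\<close> show ?thesis by blast
qed

section \<open>Injectivity of the propagation matrix\<close>

text \<open>
  Orthogonality of the characters: the entry \<open>(j, k)\<close> of the product is the mean of the powers of
  \<open>w = exp (2 pi \<i> (e j - e k) / n)\<close>, an \<open>n\<close>-th root of unity which differs from 1 if \<open>j \<noteq> k\<close>.
\<close>

lemma dft_matrix_left_inverse:
  fixes e :: "'n::finite \<Rightarrow> nat"
  assumes e: "bij_betw e UNIV {0..<CARD('n)}"
  shows "adjoint_matrix (dft_matrix e) ** dft_matrix e = mat 1"
proof -
  let ?n = "CARD('n)"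
  have "(\<Sum>l\<in>UNIV. cnj (dft_matrix e $ l $ j) * dft_matrix e $ l $ k) = (if j = k then 1 else 0)" for j k
  proof -
    define w where "w = exp (2 * complex_of_real pi * \<i> * of_int (int (e j) - int (e k)) / of_nat ?n)"
    have sqrt_n: "complex_of_real (sqrt ?n) * complex_of_real (sqrt ?n) = of_nat ?n"
      by (simp flip: of_real_mult)
    have entry: "cnj (dft_matrix e $ l $ j) * dft_matrix e $ l $ k = w ^ e l / of_nat ?n" for l
    proof -
      have "cnj (dft_matrix e $ l $ j) * dft_matrix e $ l $ k =
        exp (2 * complex_of_real pi * \<i> * of_nat (e l) * of_nat (e j) / of_nat ?n) *
        exp (- 2 * complex_of_real pi * \<i> * of_nat (e l) * of_nat (e k) / of_nat ?n) /
        of_nat ?n"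
        by (simp add: dft_matrix_def exp_cnj sqrt_n)
      also have "\<dots> = w ^ e l / of_nat ?n"
        unfolding w_def exp_of_nat_mult[symmetric] exp_add[symmetric]
        by (simp add: field_simps)
      finally show ?thesis .
    qed
    have "(\<Sum>l\<in>UNIV. cnj (dft_matrix e $ l $ j) * dft_matrix e $ l $ k) =
        (\<Sum>l\<in>{0..<?n}. w ^ l) / of_nat ?n"
      unfolding entry sum_divide_distrib using e by (rule sum.reindex_bij_betw)
    also have "\<dots> = (if j = k then 1 else 0)"
    proof (cases "j = k")
      case True
      then show ?thesis by (simp add: w_def)
    next
      case False
      have ej: "e j < ?n" "e k < ?n" "e j \<noteq> e k"
        using e False by (auto simp: bij_betw_def inj_on_def)
      have "w \<noteq> 1"
      proof
        assume "w = 1"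
        then obtain m :: int where
          "2 * pi * (int (e j) - int (e k)) / ?n = of_int (2 * m) * pi"
          by (auto simp: w_def exp_eq_1)
        then have "(2 * pi) * real_of_int (int (e j) - int (e k)) = (2 * pi) * real_of_int (m * int ?n)"
          by (simp add: field_simps)
        then have "real_of_int (int (e j) - int (e k)) = real_of_int (m * int ?n)"
          by (subst (asm) mult_left_cancel) auto
        then have "int (e j) - int (e k) = m * int ?n" by (rule of_int_eq_iff[THEN iffD1])
        then have "int ?n dvd int (e j) - int (e k)" by simp
        then have "int ?n \<le> \<bar>int (e j) - int (e k)\<bar>"
          using dvd_imp_le_int[of "int (e j) - int (e k)" "int ?n"] ej by simp
        then show False using ej by linarith
      qed
      moreover have "w ^ ?n = 1"
      proof -
        have "w ^ ?n = exp (2 * complex_of_real pi * \<i> * of_int (int (e j) - int (e k)))"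
          unfolding w_def exp_of_nat_mult[symmetric] by simp
        also have "\<dots> = 1"
          unfolding exp_eq_1 by (auto intro!: exI[of _ "int (e j) - int (e k)"])
        finally show ?thesis .
      qed
      ultimately show ?thesis using False by (simp add: geometric_sum atLeast0LessThan)
    qed
    finally show ?thesis .
  qed
  then show ?thesis by (simp add: matrix_matrix_mult_def adjoint_matrix_def mat_def vec_eq_iff)
qed

text \<open>Each of the blocks already determines the vector.\<close>

lemma propagation_matrix_inj:
  fixes D :: "'m::finite \<Rightarrow> complex ^ 'n ^ 'n"
  assumes F: "G ** F = mat 1" and D: "\<And>j. unitary_matrix (D j)"
  shows "inj (\<lambda>x. propagation_matrix F D *v x)"
proof (rule injI)
  fix x y assume eq: "propagation_matrix F D *v x = propagation_matrix F D *v y"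
  fix j :: 'm
  have row: "(propagation_matrix F D *v z) $ (j, k) =
      complex_of_real (1 / sqrt (real CARD('m))) * ((F ** D j) *v z) $ k" for z k
    by (simp add: propagation_matrix_def matrix_vector_mult_def sum_distrib_left mult.assoc)
  have "((F ** D j) *v x) $ k = ((F ** D j) *v y) $ k" for k
    using arg_cong[OF eq, of "\<lambda>v. v $ (j, k)"] unfolding row by simp
  then have "(F ** D j) *v x = (F ** D j) *v y" by (simp add: vec_eq_iff)
  then have "(adjoint_matrix (D j) ** G) *v ((F ** D j) *v x) =
      (adjoint_matrix (D j) ** G) *v ((F ** D j) *v y)" by simp
  moreover have "(adjoint_matrix (D j) ** G) ** (F ** D j) = mat 1"
    using D[of j] F unfolding unitary_matrix_def by (metis matrix_mul_assoc matrix_mul_lid)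
  ultimately show "x = y" by (simp add: matrix_vector_mul_assoc)
qed

section \<open>Linear convergence of DRAP near a solution\<close>

theorem theorem2:
  fixes e :: "'n::finite \<Rightarrow> nat"
    and D :: "'m::finite \<Rightarrow> complex ^ 'n ^ 'n"
    and r :: "real ^ ('m \<times> 'n)"
    and X :: "(complex ^ 'n) set"
    and A B :: "(complex ^ ('m \<times> 'n)) set"
    and yh :: "complex ^ ('m \<times> 'n)"
    and lam :: real
  assumes m: "CARD('m) \<ge> 2"
    and enum: "bij_betw e UNIV {0..<CARD('n)}"
    and D_unitary: "\<And>j. unitary_matrix (D j)"
    and r_nonneg: "\<And>i. r $ i \<ge> 0"
    and X: "closed X" "convex X"
    and A: "A = (\<lambda>x. propagation_matrix (dft_matrix e) D *v x) ` X"
    and B: "B = {y. \<forall>i. (cmod (y $ i))\<^sup>2 = r $ i}"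
    and yh: "yh \<in> A \<inter> B"
    and lam: "0 \<le> lam" "lam \<le> 1"
    and subreg: "metrically_subregular (\<lambda>y. (\<lambda>t. t - y) ` drap lam A B y) yh 0"
  shows "\<exists>\<epsilon>>0. \<forall>y :: nat \<Rightarrow> complex ^ ('m \<times> 'n).
           y 0 \<in> ball yh \<epsilon> \<and> (\<forall>k. y (Suc k) \<in> drap lam A B (y k)) \<longrightarrow>
           (\<exists>yt. yt \<in> drap lam A B yt \<and> converges_linearly_to y yt)"
proof -
  let ?M = "propagation_matrix (dft_matrix e) D"
  have lin: "linear (\<lambda>x. ?M *v x)"
    by (rule linearI) (simp_all add: matrix_vector_mult_def vec_eq_iff
        scaleR_sum_right sum.distrib distrib_left)
  have "closed A"
    unfolding A using X(1) lin propagation_matrix_inj[OF dft_matrix_left_inverse[OF enum] D_unitary]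
    by (rule closed_injective_linear_image)
  have "convex A" unfolding A using lin X(2) by (rule convex_linear_image)
  have "closed B" unfolding B by (rule closed_modulus_constraint)
  have nonempty: "drap lam A B x \<noteq> {}" for x
  proof -
    obtain b where b: "b \<in> projector B x"
      using projector_nonempty[OF \<open>closed B\<close>, of x] yh by auto
    obtain p where p: "p \<in> projector A ((1 + lam) *\<^sub>R b - lam *\<^sub>R x)"
      using projector_nonempty[OF \<open>closed A\<close>, of "(1 + lam) *\<^sub>R b - lam *\<^sub>R x"] yh by auto
    from b p have "p - lam *\<^sub>R (b - x) \<in> drap lam A B x"
      unfolding drap_def by blast
    then show ?thesis by blast
  qed
  have "yh \<in> projector B yh" "yh \<in> projector A ((1 + lam) *\<^sub>R yh - lam *\<^sub>R yh)"
    using yh by (auto simp: algebra_simps intro: projector_self)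
  then have "yh - lam *\<^sub>R (yh - yh) \<in> drap lam A B yh" unfolding drap_def by blast
  then have fixed: "yh \<in> drap lam A B yh" by simp
  have avg: "\<exists>R>0. almost_averaged_on (ball yh R) \<epsilon> (drap lam A B)" if "0 < \<epsilon>" for \<epsilon>
  proof -
    from that yh obtain R where "R > 0" and
      mono: "\<And>x y b b'. x \<in> ball yh R \<Longrightarrow> y \<in> ball yh R \<Longrightarrow> b \<in> projector B x \<Longrightarrow> b' \<in> projector B y \<Longrightarrow>
        (b - b') \<bullet> ((x - y) - (b - b')) \<ge> - (\<epsilon> / 2) * (norm (x - y))\<^sup>2"
      using modulus_projector_almost_monotone[of yh r "\<epsilon> / 2"] unfolding B by auto
    from \<open>R > 0\<close> drap_almost_averaged[OF lam \<open>closed A\<close> \<open>convex A\<close> mono]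
    show ?thesis by blast
  qed
  show ?thesis
    by (rule almost_averaged_subregular_linear_convergence[OF avg nonempty fixed subreg])
qed

end
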